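(* Let $T$ be a normal lax monad on a thin equipment $\mathcal K$. Let $A$, $B$ and $M$ be $T$-graphs with $M$ $T$-cocomplete, let $J\colon A\nrightarrow B$ be a $T$-open horizontal morphism and let $e\colon B\to M$ be a $T$-morphism. If the right Kan extension $r\colon A\to M$ of $e$ along $J$ in $\mathcal K$ exists, then $r$ is a $T$-morphism.
   Context: A thin equipment $\mathcal K$ consists of two categories on the same collection of objects: one with composition $\circ$ and identities $\mathrm{id}$, whose morphisms $f\colon A\to C$ are called vertical, and one with composition $\odot$ (written in diagrammatic order) and identities $1_A$, whose morphisms $J\colon A\nrightarrow B$ are called horizontal; together with a collection of cells. A cell has a boundary consisting of a top $J\colon A\nrightarrow B$, a bottom $K\colon C\nrightarrow D$, a left side $f\colon A\to C$ and a right side $g\colon B\to D$, and is uniquely determined by its boundary; write $J\Rightarrow_{f,g}K$ if the cell with this boundary exists. The axioms are: (i) $J\Rightarrow_{f,g}K$ and $K\Rightarrow_{h,k}L$ imply $J\Rightarrow_{h\circ f,k\circ g}L$, and $J\Rightarrow_{f,g}K$ and $H\Rightarrow_{g,l}N$ imply $J\odot H\Rightarrow_{f,l}K\odot N$; (ii) $1_A\Rightarrow_{f,f}1_C$ for all $f\colon A\to C$ and $J\Rightarrow_{\mathrm{id},\mathrm{id}}J$ for all $J$; (iii) writing $J\le K$ for $J\Rightarrow_{\mathrm{id},\mathrm{id}}K$, if $J\le K$ and $K\le J$ then $J=K$; (iv) each vertical $f\colon A\to C$ has a companion $f_*\colon A\nrightarrow C$ with $f_*\Rightarrow_{f,\mathrm{id}_C}1_C$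 and $1_A\Rightarrow_{\mathrm{id}_A,f}f_*$, and a conjoint $f^*\colon C\nrightarrow A$ with $f^*\Rightarrow_{\mathrm{id}_C,f}1_C$ and $1_A\Rightarrow_{f,\mathrm{id}_A}f^*$ (these are necessarily unique). A lax functor $F$ between thin equipments consists of a functor on the vertical categories together with an assignment $(J\colon A\nrightarrow B)\mapsto(FJ\colon FA\nrightarrow FB)$ such that $1_{FA}\le F1_A$, $FJ\odot FH\le F(J\odot H)$, and $J\Rightarrow_{f,g}K$ implies $FJ\Rightarrow_{Ff,Fg}FK$. It is normal if $F1_A=1_{FA}$ for all $A$. A transformation $\xi\colon F\Rightarrow G$ of lax functors is a natural transformation between the vertical functors such that $FJ\Rightarrow_{\xi_A,\xi_B}GJ$ for every $J\colon A\nrightarrow B$. A lax monad $T=(T,\mu,\iota)$ on $\mathcal K$ is a lax functor $T\colon\mathcal K\to\mathcal K$ with transformations $\mu\colon T^2\Rightarrow T$ and $\iota\colon\mathrm{id}_{\mathcal K}\Rightarrow T$ satisfying the usual monad associativity and unit axioms; it is normal if its underlying lax functor is. A $T$-graph is an object $A$ with a horizontal morphism $\alpha\colon TA\nrightarrow A$ such that $1_A\Rightarrow_{\iota_A,\mathrm{id}_A}\alpha$. A $T$-morphism $f\colon(A,\alpha)\to(C,\gamma)$ is a vertical morphism $f\colon A\to C$ with $\alpha\Rightarrow_{Tf,f}\gamma$. A $T$-graph $(M,\nu)$ is $T$-cocomplete if $\nu=m_*$ for some vertical morphism $m\colon TM\to M$. A horizontal morphism $J\colon A\nrightarrow B$ between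 $T$-graphs $(A,\alpha)$ and $(B,\beta)$ is $T$-open if $\alpha\odot J\le TJ\odot\beta$. Given $e\colon B\to M$ and $J\colon A\nrightarrow B$, a vertical morphism $r\colon A\to M$ is the right Kan extension of $e$ along $J$ if $J\Rightarrow_{r,e}1_M$ and, for all $H\colon C\nrightarrow A$ and $f\colon C\to M$, $H\odot J\Rightarrow_{f,e}1_M$ implies $H\Rightarrow_{f,r}1_M$. *)

theory Defs
  imports Main
begin

text \<open>Composition is written in diagrammatic order here. The hom sets are disjoint because
  every arrow carries its domain and codomain; outside of the carriers nothing is assumed.\<close>

locale category =
  fixes Ob :: "'o set" and Ar :: "'m set" and dm :: "'m \<Rightarrow> 'o" and cd :: "'m \<Rightarrow> 'o"
    and ident :: "'o \<Rightarrow> 'm" and comp :: "'m \<Rightarrow> 'm \<Rightarrow> 'm"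
  assumes dm_in: "f \<in> Ar \<Longrightarrow> dm f \<in> Ob"
    and cd_in: "f \<in> Ar \<Longrightarrow> cd f \<in> Ob"
    and ident_in: "A \<in> Ob \<Longrightarrow> ident A \<in> Ar"
    and dm_ident: "A \<in> Ob \<Longrightarrow> dm (ident A) = A"
    and cd_ident: "A \<in> Ob \<Longrightarrow> cd (ident A) = A"
    and comp_in: "\<lbrakk>f \<in> Ar; g \<in> Ar; cd f = dm g\<rbrakk> \<Longrightarrow> comp f g \<in> Ar"
    and dm_comp: "\<lbrakk>f \<in> Ar; g \<in> Ar; cd f = dm g\<rbrakk> \<Longrightarrow> dm (comp f g) = dm f"
    and cd_comp: "\<lbrakk>f \<in> Ar; g \<in> Ar; cd f = dm g\<rbrakk> \<Longrightarrow> cd (comp f g) = cd g"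
    and comp_assoc: "\<lbrakk>f \<in> Ar; g \<in> Ar; h \<in> Ar; cd f = dm g; cd g = dm h\<rbrakk>
      \<Longrightarrow> comp (comp f g) h = comp f (comp g h)"
    and comp_ident_left: "f \<in> Ar \<Longrightarrow> comp (ident (dm f)) f = f"
    and comp_ident_right: "f \<in> Ar \<Longrightarrow> comp f (ident (cd f)) = f"

text \<open>As a cell is determined by its boundary, the collection of cells is a relation:
  \<open>cell K J f g L\<close> says that the cell with top \<open>J\<close>, left side \<open>f\<close>, right side \<open>g\<close> and
  bottom \<open>L\<close> exists.\<close>

record ('o, 'v, 'h) equipment =
  Obj :: "'o set"
  Ver :: "'v set"
  vdom :: "'v \<Rightarrow> 'o"
  vcod :: "'v \<Rightarrow> 'o"
  vid :: "'o \<Rightarrow> 'v"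
  vcomp :: "'v \<Rightarrow> 'v \<Rightarrow> 'v"  (infixr "\<circ>\<index>" 75)
  Hor :: "'h set"
  hdom :: "'h \<Rightarrow> 'o"
  hcod :: "'h \<Rightarrow> 'o"
  hid :: "'o \<Rightarrow> 'h"
  hcomp :: "'h \<Rightarrow> 'h \<Rightarrow> 'h"  (infixl "\<odot>\<index>" 70)
  cell :: "'h \<Rightarrow> 'v \<Rightarrow> 'v \<Rightarrow> 'h \<Rightarrow> bool"

definition vhom :: "('o, 'v, 'h) equipment \<Rightarrow> 'o \<Rightarrow> 'o \<Rightarrow> 'v set" where
  "vhom K A C = {f \<in> Ver K. vdom K f = A \<and> vcod K f = C}"

definition hhom :: "('o, 'v, 'h) equipment \<Rightarrow> 'o \<Rightarrow> 'o \<Rightarrow> 'h set" where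
  "hhom K A B = {J \<in> Hor K. hdom K J = A \<and> hcod K J = B}"

definition hle :: "('o, 'v, 'h) equipment \<Rightarrow> 'h \<Rightarrow> 'h \<Rightarrow> bool"  (infix "\<sqsubseteq>\<index>" 50) where
  "J \<sqsubseteq>\<^bsub>K\<^esub> L \<longleftrightarrow> cell K J (vid K (hdom K J)) (vid K (hcod K J)) L"

definition is_companion :: "('o, 'v, 'h) equipment \<Rightarrow> 'v \<Rightarrow> 'h \<Rightarrow> bool" where
  "is_companion K f J \<longleftrightarrow>
     J \<in> hhom K (vdom K f) (vcod K f) \<and>
     cell K J f (vid K (vcod K f)) (hid K (vcod K f)) \<and>
     cell K (hid K (vdom K f)) (vid K (vdom K f)) f J"

definition is_conjoint :: "('o, 'v, 'h) equipment \<Rightarrow> 'v \<Rightarrow> 'h \<Rightarrow> bool" where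
  "is_conjoint K f J \<longleftrightarrow>
     J \<in> hhom K (vcod K f) (vdom K f) \<and>
     cell K J (vid K (vcod K f)) f (hid K (vcod K f)) \<and>
     cell K (hid K (vdom K f)) f (vid K (vdom K f)) J"

locale thin_equipment =
  vertical: category "Obj K" "Ver K" "vdom K" "vcod K" "vid K" "\<lambda>f g. g \<circ>\<^bsub>K\<^esub> f" +
  horizontal: category "Obj K" "Hor K" "hdom K" "hcod K" "hid K" "hcomp K"
  for K :: "('o, 'v, 'h) equipment" (structure) +
  assumes cell_boundary: "cell K J f g L \<Longrightarrow>
      f \<in> Ver K \<and> g \<in> Ver K \<and> J \<in> hhom K (vdom K f) (vdom K g) \<and> L \<in> hhom K (vcod K f) (vcod K g)"
    and cell_vcomp: "\<lbrakk>cell K J f g L; cell K L h k N\<rbrakk> \<Longrightarrow> cell K J (h \<circ>\<^bsub>K\<^esub> f) (k \<circ>\<^bsub>K\<^esub> g) N"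
    and cell_hcomp: "\<lbrakk>cell K J f g L; cell K H g l N\<rbrakk> \<Longrightarrow> cell K (J \<odot> H) f l (L \<odot> N)"
    and cell_hid: "f \<in> vhom K A C \<Longrightarrow> cell K (hid K A) f f (hid K C)"
    and hle_refl: "J \<in> Hor K \<Longrightarrow> J \<sqsubseteq> J"
    and hle_antisym: "\<lbrakk>J \<sqsubseteq> L; L \<sqsubseteq> J\<rbrakk> \<Longrightarrow> J = L"
    and ex_companion: "f \<in> Ver K \<Longrightarrow> \<exists>J. is_companion K f J"
    and ex_conjoint: "f \<in> Ver K \<Longrightarrow> \<exists>J. is_conjoint K f J"

definition companion :: "('o, 'v, 'h) equipment \<Rightarrow> 'v \<Rightarrow> 'h" where
  "companion K f = (THE J. is_companion K f J)"

lemma (in thin_equipment) is_companion_hle: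
  assumes f: "f \<in> Ver K" and J: "is_companion K f J" and L: "is_companion K f L"
  shows "J \<sqsubseteq> L"
proof -
  have "cell K (hid K (vdom K f) \<odot> J) (vid K (vdom K f)) (vid K (vcod K f)) (L \<odot> hid K (vcod K f))"
    using J L unfolding is_companion_def by (blast intro: cell_hcomp)
  then show ?thesis
    using J L horizontal.comp_ident_left[of J] horizontal.comp_ident_right[of L]
    by (simp add: is_companion_def hhom_def hle_def)
qed

lemma (in thin_equipment) is_companion_companion:
  assumes "f \<in> Ver K"
  shows "is_companion K f (companion K f)"
  unfolding companion_def
  by (rule theI') (metis assms ex_companion is_companion_hle hle_antisym)

record ('o1, 'v1, 'h1, 'o2, 'v2, 'h2) equipment_map =
  on_obj :: "'o1 \<Rightarrow> 'o2"
  on_ver :: "'v1 \<Rightarrow> 'v2"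
  on_hor :: "'h1 \<Rightarrow> 'h2"

definition id_map :: "('o, 'v, 'h, 'o, 'v, 'h) equipment_map" where
  "id_map = \<lparr>on_obj = (\<lambda>A. A), on_ver = (\<lambda>f. f), on_hor = (\<lambda>J. J)\<rparr>"

definition comp_map ::
  "('o2, 'v2, 'h2, 'o3, 'v3, 'h3) equipment_map \<Rightarrow> ('o1, 'v1, 'h1, 'o2, 'v2, 'h2) equipment_map
   \<Rightarrow> ('o1, 'v1, 'h1, 'o3, 'v3, 'h3) equipment_map" where
  "comp_map G F = \<lparr>on_obj = (\<lambda>A. on_obj G (on_obj F A)), on_ver = (\<lambda>f. on_ver G (on_ver F f)),
     on_hor = (\<lambda>J. on_hor G (on_hor F J))\<rparr>"

locale lax_functor =
  dom: thin_equipment K + cod: thin_equipment L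
  for K :: "('o1, 'v1, 'h1) equipment" and L :: "('o2, 'v2, 'h2) equipment" +
  fixes F :: "('o1, 'v1, 'h1, 'o2, 'v2, 'h2) equipment_map"
  assumes on_obj: "A \<in> Obj K \<Longrightarrow> on_obj F A \<in> Obj L"
    and on_ver: "f \<in> vhom K A C \<Longrightarrow> on_ver F f \<in> vhom L (on_obj F A) (on_obj F C)"
    and on_hor: "J \<in> hhom K A B \<Longrightarrow> on_hor F J \<in> hhom L (on_obj F A) (on_obj F B)"
    and on_vid: "A \<in> Obj K \<Longrightarrow> on_ver F (vid K A) = vid L (on_obj F A)"
    and on_vcomp: "\<lbrakk>f \<in> vhom K A B; g \<in> vhom K B C\<rbrakk>
      \<Longrightarrow> on_ver F (g \<circ>\<^bsub>K\<^esub> f) = on_ver F g \<circ>\<^bsub>L\<^esub> on_ver F f"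
    and lax_hid: "A \<in> Obj K \<Longrightarrow> hid L (on_obj F A) \<sqsubseteq>\<^bsub>L\<^esub> on_hor F (hid K A)"
    and lax_hcomp: "\<lbrakk>J \<in> hhom K A B; H \<in> hhom K B C\<rbrakk>
      \<Longrightarrow> on_hor F J \<odot>\<^bsub>L\<^esub> on_hor F H \<sqsubseteq>\<^bsub>L\<^esub> on_hor F (J \<odot>\<^bsub>K\<^esub> H)"
    and on_cell: "cell K J f g N \<Longrightarrow> cell L (on_hor F J) (on_ver F f) (on_ver F g) (on_hor F N)"

locale normal_lax_functor = lax_functor +
  assumes normal: "A \<in> Obj K \<Longrightarrow> on_hor F (hid K A) = hid L (on_obj F A)"

locale transformation =
  source: lax_functor K L F + target: lax_functor K L G
  for K :: "('o1, 'v1, 'h1) equipment" and L :: "('o2, 'v2, 'h2) equipment"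
    and F G :: "('o1, 'v1, 'h1, 'o2, 'v2, 'h2) equipment_map" +
  fixes \<xi> :: "'o1 \<Rightarrow> 'v2"
  assumes component: "A \<in> Obj K \<Longrightarrow> \<xi> A \<in> vhom L (on_obj F A) (on_obj G A)"
    and natural: "f \<in> vhom K A C \<Longrightarrow> \<xi> C \<circ>\<^bsub>L\<^esub> on_ver F f = on_ver G f \<circ>\<^bsub>L\<^esub> \<xi> A"
    and component_cell: "J \<in> hhom K A B \<Longrightarrow> cell L (on_hor F J) (\<xi> A) (\<xi> B) (on_hor G J)"

text \<open>The following two lemmas show that requiring the identity and \<open>T\<^sup>2\<close> to be lax functors, as
  the locale of transformations does, adds nothing to the definition of a lax monad.\<close>

lemma (in thin_equipment) lax_functor_id_map: "lax_functor K K id_map"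
proof unfold_locales
qed (auto simp: id_map_def vhom_def hhom_def
    intro!: hle_refl horizontal.ident_in horizontal.comp_in)

lemma (in thin_equipment) hle_trans:
  assumes "J \<sqsubseteq> L" "L \<sqsubseteq> N"
  shows "J \<sqsubseteq> N"
proof -
  have J: "J \<in> Hor K" and b: "hdom K L = hdom K J" "hcod K L = hcod K J"
    using cell_boundary[OF assms(1)[unfolded hle_def]]
    by (auto simp: hhom_def vertical.cd_ident horizontal.dm_in horizontal.cd_in)
  have "vid K A \<circ>\<^bsub>K\<^esub> vid K A = vid K A" if "A \<in> Obj K" for A
    using vertical.comp_ident_left[OF vertical.ident_in[OF that]] that
    by (simp add: vertical.dm_ident)
  then show ?thesis
    using cell_vcomp[OF assms[unfolded hle_def]] J
    by (simp add: hle_def b horizontal.dm_in horizontal.cd_in)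
qed

lemma (in lax_functor) on_hle:
  assumes "J \<sqsubseteq>\<^bsub>K\<^esub> N" and J: "J \<in> Hor K"
  shows "on_hor F J \<sqsubseteq>\<^bsub>L\<^esub> on_hor F N"
proof -
  have "on_hor F J \<in> hhom L (on_obj F (hdom K J)) (on_obj F (hcod K J))"
    using J by (intro on_hor) (simp add: hhom_def)
  then show ?thesis
    using on_cell[OF assms(1)[unfolded hle_def]] J
    by (simp add: hle_def hhom_def on_vid dom.horizontal.dm_in dom.horizontal.cd_in)
qed

lemma lax_functor_comp_map:
  assumes "lax_functor K L F" "lax_functor L N G"
  shows "lax_functor K N (comp_map G F)"
proof -
  interpret F: lax_functor K L F by fact
  interpret G: lax_functor L N G by fact
  show ?thesis
  proof unfold_locales
    fix A assume A: "A \<in> Obj K"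
    have "hid L (on_obj F A) \<in> Hor L"
      using A by (simp add: F.on_obj F.cod.horizontal.ident_in)
    then show "hid N (on_obj (comp_map G F) A) \<sqsubseteq>\<^bsub>N\<^esub> on_hor (comp_map G F) (hid K A)"
      using G.cod.hle_trans[OF G.lax_hid G.on_hle[OF F.lax_hid]] A
      by (simp add: comp_map_def F.on_obj)
  next
    fix J A B H C assume J: "J \<in> hhom K A B" and H: "H \<in> hhom K B C"
    have "on_hor F J \<odot>\<^bsub>L\<^esub> on_hor F H \<in> Hor L"
      using F.on_hor[OF J] F.on_hor[OF H] by (simp add: hhom_def F.cod.horizontal.comp_in)
    then show "on_hor (comp_map G F) J \<odot>\<^bsub>N\<^esub> on_hor (comp_map G F) H
        \<sqsubseteq>\<^bsub>N\<^esub> on_hor (comp_map G F) (J \<odot>\<^bsub>K\<^esub> H)"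
      using G.cod.hle_trans[OF G.lax_hcomp[OF F.on_hor F.on_hor] G.on_hle[OF F.lax_hcomp]] J H
      by (simp add: comp_map_def)
  qed (auto simp: comp_map_def F.on_obj G.on_obj F.on_vid G.on_vid
      F.on_vcomp G.on_vcomp[OF F.on_ver F.on_ver]
      intro: F.on_ver G.on_ver F.on_hor G.on_hor F.on_cell G.on_cell)
qed

locale lax_monad =
  endo: lax_functor K K T +
  mult: transformation K K "comp_map T T" T \<mu> +
  unit: transformation K K id_map T \<iota>
  for K :: "('o, 'v, 'h) equipment" and T :: "('o, 'v, 'h, 'o, 'v, 'h) equipment_map"
    and \<mu> \<iota> :: "'o \<Rightarrow> 'v" +
  assumes mult_assoc: "A \<in> Obj K \<Longrightarrow> \<mu> A \<circ>\<^bsub>K\<^esub> on_ver T (\<mu> A) = \<mu> A \<circ>\<^bsub>K\<^esub> \<mu> (on_obj T A)"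
    and mult_unit_left: "A \<in> Obj K \<Longrightarrow> \<mu> A \<circ>\<^bsub>K\<^esub> \<iota> (on_obj T A) = vid K (on_obj T A)"
    and mult_unit_right: "A \<in> Obj K \<Longrightarrow> \<mu> A \<circ>\<^bsub>K\<^esub> on_ver T (\<iota> A) = vid K (on_obj T A)"

locale normal_lax_monad = lax_monad K T \<mu> \<iota> + normal_lax_functor K K T
  for K :: "('o, 'v, 'h) equipment" and T :: "('o, 'v, 'h, 'o, 'v, 'h) equipment_map"
    and \<mu> \<iota> :: "'o \<Rightarrow> 'v"

definition T_graph ::
  "('o, 'v, 'h) equipment \<Rightarrow> ('o, 'v, 'h, 'o, 'v, 'h) equipment_map \<Rightarrow> ('o \<Rightarrow> 'v) \<Rightarrow> 'o \<Rightarrow> 'h \<Rightarrow> bool"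
  where "T_graph K T \<iota> A \<alpha> \<longleftrightarrow>
    A \<in> Obj K \<and> \<alpha> \<in> hhom K (on_obj T A) A \<and> cell K (hid K A) (\<iota> A) (vid K A) \<alpha>"

definition T_morphism ::
  "('o, 'v, 'h) equipment \<Rightarrow> ('o, 'v, 'h, 'o, 'v, 'h) equipment_map
   \<Rightarrow> 'o \<Rightarrow> 'h \<Rightarrow> 'o \<Rightarrow> 'h \<Rightarrow> 'v \<Rightarrow> bool"
  where "T_morphism K T A \<alpha> C \<gamma> f \<longleftrightarrow> f \<in> vhom K A C \<and> cell K \<alpha> (on_ver T f) f \<gamma>"

definition T_cocomplete ::
  "('o, 'v, 'h) equipment \<Rightarrow> ('o, 'v, 'h, 'o, 'v, 'h) equipment_map \<Rightarrow> 'o \<Rightarrow> 'h \<Rightarrow> bool"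
  where "T_cocomplete K T M \<nu> \<longleftrightarrow> (\<exists>m \<in> vhom K (on_obj T M) M. \<nu> = companion K m)"

definition T_open ::
  "('o, 'v, 'h) equipment \<Rightarrow> ('o, 'v, 'h, 'o, 'v, 'h) equipment_map
   \<Rightarrow> 'o \<Rightarrow> 'h \<Rightarrow> 'o \<Rightarrow> 'h \<Rightarrow> 'h \<Rightarrow> bool"
  where "T_open K T A \<alpha> B \<beta> J \<longleftrightarrow>
    J \<in> hhom K A B \<and> \<alpha> \<odot>\<^bsub>K\<^esub> J \<sqsubseteq>\<^bsub>K\<^esub> on_hor T J \<odot>\<^bsub>K\<^esub> \<beta>"

definition is_right_Kan_extension ::
  "('o, 'v, 'h) equipment \<Rightarrow> 'o \<Rightarrow> 'o \<Rightarrow> 'o \<Rightarrow> 'h \<Rightarrow> 'v \<Rightarrow> 'v \<Rightarrow> bool"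
  where "is_right_Kan_extension K A B M J e r \<longleftrightarrow>
    J \<in> hhom K A B \<and> e \<in> vhom K B M \<and> r \<in> vhom K A M \<and>
    cell K J r e (hid K M) \<and>
    (\<forall>C \<in> Obj K. \<forall>H \<in> hhom K C A. \<forall>f \<in> vhom K C M.
       cell K (H \<odot>\<^bsub>K\<^esub> J) f e (hid K M) \<longrightarrow> cell K H f r (hid K M))"

end

theory Submission
  imports Defs
begin

text \<open>Let \<open>\<nu> = m\<^sub>*\<close>. A cell with bottom \<open>m\<^sub>*\<close> and left side \<open>f\<close> is the same thing as a cell with
  bottom \<open>1\<^sub>M\<close> and left side \<open>m \<circ> f\<close> (lemma \<open>cell_companion_iff\<close>). Hence \<open>r\<close> is a \<open>T\<close>-morphism,
  \<open>\<alpha> \<Rightarrow> m\<^sub>*\<close> along \<open>T r\<close> and \<open>r\<close>, exactly when \<open>\<alpha> \<Rightarrow> 1\<^sub>M\<close> along \<open>m \<circ> T r\<close> and \<open>r\<close>. In the latter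
  form the right side \<open>r\<close> and the bottom \<open>1\<^sub>M\<close> are those of the universal property of the right
  Kan extension, which leaves the cell \<open>\<alpha> \<odot> J \<Rightarrow> 1\<^sub>M\<close> along \<open>m \<circ> T r\<close> and \<open>e\<close>; this in turn
  amounts to \<open>\<alpha> \<odot> J \<Rightarrow> m\<^sub>*\<close> along \<open>T r\<close> and \<open>e\<close>. By openness of \<open>J\<close> it is enough to have the
  last cell with top \<open>T J \<odot> \<beta>\<close>, where it is the composite of two cells: the image
  \<open>T J \<Rightarrow> T 1\<^sub>M\<close> of the cell \<open>J \<Rightarrow> 1\<^sub>M\<close> of the Kan extension, beside the cell \<open>\<beta> \<Rightarrow> m\<^sub>*\<close> that
  makes \<open>e\<close> a \<open>T\<close>-morphism. Normality of \<open>T\<close> makes the composite bottom \<open>T 1\<^sub>M \<odot> m\<^sub>*\<close> equal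
  to \<open>m\<^sub>*\<close>.\<close>

context thin_equipment
begin

lemma cell_hle_top:
  assumes "J \<sqsubseteq> H" and H: "cell K H f g L"
  shows "cell K J f g L"
proof -
  have b: "f \<in> Ver K" "g \<in> Ver K" "hdom K H = vdom K f" "hcod K H = vdom K g"
    using cell_boundary[OF H] by (auto simp: hhom_def)
  have J: "cell K J (vid K (hdom K J)) (vid K (hcod K J)) H"
    using assms(1) by (simp add: hle_def)
  have "J \<in> Hor K" "hdom K J = hdom K H" "hcod K J = hcod K H"
    using cell_boundary[OF J]
    by (auto simp: hhom_def vertical.cd_ident horizontal.dm_in horizontal.cd_in)
  with cell_vcomp[OF J H] show ?thesis
    using b vertical.comp_ident_left[of f] vertical.comp_ident_left[of g] by simp
qed

text \<open>The two cells of the companion bend the vertical morphism \<open>m\<close> from the left side of a cell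
  into its bottom and back, by pasting the one beside the cell and the other below it.\<close>

lemma cell_companion_iff:
  assumes f: "f \<in> vhom K A C" and m: "m \<in> vhom K C M"
    and g: "g \<in> Ver K" and L: "L \<in> Hor K" "hdom K L = M"
  shows "cell K H f g (companion K m \<odot> L) \<longleftrightarrow> cell K H (m \<circ>\<^bsub>K\<^esub> f) g L"
proof
  have L1: "hid K M \<odot> L = L"
    using horizontal.comp_ident_left[of L] L by simp
  have comp: "companion K m \<in> hhom K C M"
      "cell K (companion K m) m (vid K M) (hid K M)"
      "cell K (hid K C) (vid K C) m (companion K m)"
    using is_companion_companion[of m] m by (auto simp: is_companion_def vhom_def)
  {
    assume H: "cell K H f g (companion K m \<odot> L)"
    have "hcod K (companion K m \<odot> L) = hcod K L"
      using comp(1) L by (simp add: hhom_def horizontal.cd_comp)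
    then have g_cod: "vcod K g = hcod K L"
      using cell_boundary[OF H] by (simp add: hhom_def)
    have "cell K L (vid K M) (vid K (hcod K L)) L"
      using hle_refl[OF L(1)] L(2) by (simp add: hle_def)
    from cell_hcomp[OF comp(2) this]
    have "cell K (companion K m \<odot> L) m (vid K (hcod K L)) L"
      by (simp add: L1)
    from cell_vcomp[OF H this] show "cell K H (m \<circ>\<^bsub>K\<^esub> f) g L"
      using vertical.comp_ident_right[OF g] g_cod by simp
  }
  {
    assume H: "cell K H (m \<circ>\<^bsub>K\<^esub> f) g L"
    have "vdom K (m \<circ>\<^bsub>K\<^esub> f) = A"
      using f m by (simp add: vhom_def vertical.dm_comp)
    then have H1: "hid K A \<odot> H = H"
      using cell_boundary[OF H] horizontal.comp_ident_left[of H] by (simp add: hhom_def)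
    have "vid K C \<circ>\<^bsub>K\<^esub> f = f"
      using f vertical.comp_ident_right[of f] by (auto simp: vhom_def)
    with cell_vcomp[OF cell_hid[OF f] comp(3)]
    have "cell K (hid K A) f (m \<circ>\<^bsub>K\<^esub> f) (companion K m)" by simp
    from cell_hcomp[OF this H] show "cell K H f g (companion K m \<odot> L)"
      by (simp add: H1)
  }
qed

end

theorem theorem7p1:
  fixes K :: "('o, 'v, 'h) equipment"
    and T :: "('o, 'v, 'h, 'o, 'v, 'h) equipment_map"
    and \<mu> \<iota> :: "'o \<Rightarrow> 'v"
    and A B M :: 'o and \<alpha> \<beta> \<nu> J :: 'h and e r :: 'v
  assumes "normal_lax_monad K T \<mu> \<iota>"
    and "T_graph K T \<iota> A \<alpha>" and "T_graph K T \<iota> B \<beta>" and "T_graph K T \<iota> M \<nu>"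
    and "T_cocomplete K T M \<nu>"
    and "T_open K T A \<alpha> B \<beta> J"
    and "T_morphism K T B \<beta> M \<nu> e"
    and "is_right_Kan_extension K A B M J e r"
  shows "T_morphism K T A \<alpha> M \<nu> r"
proof -
  interpret normal_lax_monad K T \<mu> \<iota> by fact
  have A: "A \<in> Obj K" "\<alpha> \<in> hhom K (on_obj T A) A"
    and M: "M \<in> Obj K" "\<nu> \<in> hhom K (on_obj T M) M"
    using assms(2,4) by (auto simp: T_graph_def)
  from assms(5) obtain m where m: "m \<in> vhom K (on_obj T M) M" and \<nu>: "\<nu> = companion K m"
    by (auto simp: T_cocomplete_def)
  from assms(7) have e: "e \<in> Ver K" "cell K \<beta> (on_ver T e) e \<nu>"
    by (auto simp: T_morphism_def vhom_def)
  from assms(6) have J: "\<alpha> \<odot>\<^bsub>K\<^esub> J \<sqsubseteq>\<^bsub>K\<^esub> on_hor T J \<odot>\<^bsub>K\<^esub> \<beta>"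
    by (simp add: T_open_def)
  from assms(8) have r: "r \<in> vhom K A M" "cell K J r e (hid K M)"
    and universal: "\<And>C H f. \<lbrakk>C \<in> Obj K; H \<in> hhom K C A; f \<in> vhom K C M;
      cell K (H \<odot>\<^bsub>K\<^esub> J) f e (hid K M)\<rbrakk> \<Longrightarrow> cell K H f r (hid K M)"
    by (auto simp: is_right_Kan_extension_def)
  have Tr: "on_ver T r \<in> vhom K (on_obj T A) (on_obj T M)"
    by (rule endo.on_ver[OF r(1)])
  have TA: "on_obj T A \<in> Obj K"
    by (rule endo.on_obj[OF A(1)])
  have bend: "cell K H (on_ver T r) g \<nu> \<longleftrightarrow> cell K H (m \<circ>\<^bsub>K\<^esub> on_ver T r) g (hid K M)"
    if "g \<in> Ver K" for H g
  proof -
    have "companion K m \<odot>\<^bsub>K\<^esub> hid K M = \<nu>"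
      using M(2) \<nu> endo.dom.horizontal.comp_ident_right[of \<nu>] by (auto simp: hhom_def)
    then show ?thesis
      using endo.dom.cell_companion_iff[OF Tr m that endo.dom.horizontal.ident_in[OF M(1)]
          endo.dom.horizontal.dm_ident[OF M(1)]] by simp
  qed
  have "cell K (on_hor T J) (on_ver T r) (on_ver T e) (hid K (on_obj T M))"
    using endo.on_cell[OF r(2)] normal[OF M(1)] by simp
  from endo.dom.cell_hcomp[OF this e(2)]
  have "cell K (on_hor T J \<odot>\<^bsub>K\<^esub> \<beta>) (on_ver T r) e \<nu>"
    using M(2) endo.dom.horizontal.comp_ident_left[of \<nu>] by (auto simp: hhom_def)
  with J have "cell K (\<alpha> \<odot>\<^bsub>K\<^esub> J) (on_ver T r) e \<nu>"
    by (rule endo.dom.cell_hle_top)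
  then have "cell K (\<alpha> \<odot>\<^bsub>K\<^esub> J) (m \<circ>\<^bsub>K\<^esub> on_ver T r) e (hid K M)"
    using bend[OF e(1)] by simp
  moreover have "m \<circ>\<^bsub>K\<^esub> on_ver T r \<in> vhom K (on_obj T A) M"
    using Tr m by (simp add: vhom_def endo.dom.vertical.comp_in endo.dom.vertical.dm_comp endo.dom.vertical.cd_comp)
  ultimately have "cell K \<alpha> (m \<circ>\<^bsub>K\<^esub> on_ver T r) r (hid K M)"
    using universal[OF TA A(2)] by simp
  then have "cell K \<alpha> (on_ver T r) r \<nu>"
    using bend r(1) by (simp add: vhom_def)
  with r(1) show ?thesis
    by (simp add: T_morphism_def)
qed

end
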